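(* Let $R$ be an integral domain that is not a field. If the set of units $R^\times$ is not open in $M(R)$, then the set of maximal ideals of $R$ is infinite.
   Context: For $X\subset R$, $X^0=X\setminus\{0\}$; $\langle r\rangle$ is the ideal of $R$ generated by $r$. For $r\in R$ let $\sigma_r=\{s\in R:\langle r\rangle+\langle s\rangle=R\}$. The Macías space $M(R)$ is the set $R^0$ with the topology having the basis $\{\sigma_k^0: k\in R^0\}$. *)

theory Defs
  imports "HOL-Analysis.Abstract_Topology" "HOL-Algebra.Ideal"
begin

definition macias_sigma :: "('a, 'm) ring_scheme \<Rightarrow> 'a \<Rightarrow> 'a set" where
  "macias_sigma R r =
     {s \<in> carrier R. Idl\<^bsub>R\<^esub> {r} <+>\<^bsub>R\<^esub> Idl\<^bsub>R\<^esub> {s} = carrier R}"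

definition macias_basis :: "('a, 'm) ring_scheme \<Rightarrow> 'a set set" where
  "macias_basis R =
     {macias_sigma R k - {\<zero>\<^bsub>R\<^esub>} | k. k \<in> carrier R - {\<zero>\<^bsub>R\<^esub>}}"

(* The function topology is only meaningful on predicates satisfying istopology;
   openin_macias_space and topspace_macias_space below confirm that, for a domain,
   this is the topology on the nonzero elements with basis macias_basis R. *)
definition macias_space :: "('a, 'm) ring_scheme \<Rightarrow> 'a topology" where
  "macias_space R = topology (arbitrary union_of (\<lambda>U. U \<in> macias_basis R))"

lemma (in cring) macias_sigma_iff:
  assumes r: "r \<in> carrier R" and s: "s \<in> carrier R"
  shows "s \<in> macias_sigma R r \<longleftrightarrow>
    (\<exists>a\<in>carrier R. \<exists>b\<in>carrier R. a \<otimes> r \<oplus> b \<otimes> s = \<one>)"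
proof -
  have id: "ideal (PIdl r <+> PIdl s) R"
    by (intro add_ideals cgenideal_ideal r s)
  have "s \<in> macias_sigma R r \<longleftrightarrow> PIdl r <+> PIdl s = carrier R"
    using s by (simp add: macias_sigma_def cgenideal_eq_genideal[OF r] cgenideal_eq_genideal[OF s])
  also have "\<dots> \<longleftrightarrow> \<one> \<in> PIdl r <+> PIdl s"
    using ideal.one_imp_carrier[OF id] by auto
  also have "\<dots> \<longleftrightarrow> (\<exists>a\<in>carrier R. \<exists>b\<in>carrier R. a \<otimes> r \<oplus> b \<otimes> s = \<one>)"
    by (auto simp: set_add_def' cgenideal_def) metis+
  finally show ?thesis .
qed

lemma (in cring) macias_sigma_mult:
  assumes k: "k \<in> carrier R" and l: "l \<in> carrier R"
  shows "macias_sigma R (k \<otimes> l) = macias_sigma R k \<inter> macias_sigma R l"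
proof (intro equalityI subsetI)
  fix s assume s: "s \<in> macias_sigma R (k \<otimes> l)"
  then have sc: "s \<in> carrier R" by (simp add: macias_sigma_def)
  obtain a b where ab: "a \<in> carrier R" "b \<in> carrier R" "a \<otimes> (k \<otimes> l) \<oplus> b \<otimes> s = \<one>"
    using s macias_sigma_iff[OF m_closed[OF k l] sc] by blast
  have "(a \<otimes> l) \<otimes> k \<oplus> b \<otimes> s = \<one>" "(a \<otimes> k) \<otimes> l \<oplus> b \<otimes> s = \<one>"
    using ab k l by (simp_all add: m_ac)
  then show "s \<in> macias_sigma R k \<inter> macias_sigma R l"
    using ab k l sc macias_sigma_iff[OF k sc] macias_sigma_iff[OF l sc] m_closed by blast
next
  fix s assume s: "s \<in> macias_sigma R k \<inter> macias_sigma R l"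
  then have sc: "s \<in> carrier R" by (simp add: macias_sigma_def)
  obtain a b where ab: "a \<in> carrier R" "b \<in> carrier R" "a \<otimes> k \<oplus> b \<otimes> s = \<one>"
    using s macias_sigma_iff[OF k sc] by blast
  obtain c d where cd: "c \<in> carrier R" "d \<in> carrier R" "c \<otimes> l \<oplus> d \<otimes> s = \<one>"
    using s macias_sigma_iff[OF l sc] by blast
  have "(a \<otimes> c) \<otimes> (k \<otimes> l) \<oplus> (a \<otimes> k \<otimes> d \<oplus> b) \<otimes> s
        = (a \<otimes> k) \<otimes> (c \<otimes> l \<oplus> d \<otimes> s) \<oplus> b \<otimes> s"
    using ab(1,2) cd(1,2) k l sc by (simp add: l_distr r_distr m_ac a_ac)
  also have "\<dots> = \<one>"
    using ab cd(3) k by simp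
  finally show "s \<in> macias_sigma R (k \<otimes> l)"
    using ab cd k l sc macias_sigma_iff[OF m_closed[OF k l] sc] m_closed a_closed by blast
qed

lemma (in domain) openin_macias_space:
  "openin (macias_space R) = arbitrary union_of (\<lambda>U. U \<in> macias_basis R)"
  unfolding macias_space_def
proof (rule topology_inverse', rule istopology_base)
  fix S T assume "S \<in> macias_basis R" "T \<in> macias_basis R"
  then obtain k l where kl: "k \<in> carrier R - {\<zero>}" "l \<in> carrier R - {\<zero>}"
    and ST: "S = macias_sigma R k - {\<zero>}" "T = macias_sigma R l - {\<zero>}"
    by (auto simp: macias_basis_def)
  have "S \<inter> T = macias_sigma R (k \<otimes> l) - {\<zero>}"
    using kl by (auto simp: ST macias_sigma_mult)
  moreover have "k \<otimes> l \<in> carrier R - {\<zero>}"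
    using kl by (auto simp: integral_iff)
  ultimately show "S \<inter> T \<in> macias_basis R"
    unfolding macias_basis_def by blast
qed

lemma (in domain) topspace_macias_space:
  "topspace (macias_space R) = carrier R - {\<zero>}"
proof
  show "topspace (macias_space R) \<subseteq> carrier R - {\<zero>}"
    by (auto simp: topspace_def openin_macias_space union_of_def arbitrary_def
        macias_basis_def macias_sigma_def)
  have "s \<in> macias_sigma R \<one>" if "s \<in> carrier R" for s
    using that
    by (intro iffD2[OF macias_sigma_iff[OF one_closed that]] bexI[of _ \<one>] bexI[of _ \<zero>]) auto
  then have "carrier R - {\<zero>} = macias_sigma R \<one> - {\<zero>}"
    by (auto simp: macias_sigma_def)
  then have "carrier R - {\<zero>} \<in> macias_basis R"
    unfolding macias_basis_def using one_closed one_not_zero by blast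
  then have "openin (macias_space R) (carrier R - {\<zero>})"
    by (simp add: openin_macias_space union_of_inc arbitrary_def)
  then show "carrier R - {\<zero>} \<subseteq> topspace (macias_space R)"
    by (rule openin_subset)
qed

end

theory Submission
  imports Defs "HOL-Algebra.Ring_Divisibility"
begin

text \<open>
  The proof is by contraposition: if there are only finitely many maximal ideals, then
  the unit group is itself a basic open set.  Since \<^term>\<open>R\<close> is not a field, every maximal
  ideal is nonzero, and since \<^term>\<open>R\<close> is a domain, multiplying one nonzero element from each
  of the finitely many maximal ideals gives a nonzero element \<open>k\<close> of the Jacobson radical
  (\<open>exists_nonzero_in_all_ideals\<close>).  An element \<open>s\<close> comaximal with such a \<open>k\<close> lies in no
  maximal ideal, as that ideal would contain both \<open>k\<close> and \<open>s\<close>; hence, by Krull's theorem, it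
  is a unit.  So \<open>\<sigma>\<close> of \<open>k\<close> is exactly the set of units
  (\<open>macias_sigma_eq_Units\<close>), and the units are open.
\<close>

text \<open>
  Krull's theorem, by Zorn's lemma on the ideals that contain \<open>I\<close> and avoid \<open>\<one>\<close>: properness
  is expressed by avoiding a single element, so it survives unions of chains.
\<close>
lemma (in ring) exists_maximalideal_superset:
  assumes I: "ideal I R" and proper: "\<one> \<notin> I"
  shows "\<exists>M. maximalideal M R \<and> I \<subseteq> M"
proof -
  let ?A = "{J. ideal J R \<and> I \<subseteq> J \<and> \<one> \<notin> J}"
  have "\<exists>M\<in>?A. \<forall>X\<in>?A. M \<subseteq> X \<longrightarrow> X = M"
  proof (rule subset_Zorn_nonempty)
    show "?A \<noteq> {}" using I proper by blast
  next
    fix C assume ne: "C \<noteq> {}" and C: "subset.chain ?A C"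
    then have "subset.chain {J. ideal J R} C"
      unfolding pred_on.chain_def by blast
    then have "ideal (\<Union>C) R"
      using chain_Union_is_ideal[of C] ne by simp
    then show "\<Union>C \<in> ?A"
      using ne C unfolding pred_on.chain_def by blast
  qed
  then obtain M where M: "ideal M R" "I \<subseteq> M" "\<one> \<notin> M"
    and max: "\<And>X. ideal X R \<Longrightarrow> I \<subseteq> X \<Longrightarrow> \<one> \<notin> X \<Longrightarrow> M \<subseteq> X \<Longrightarrow> X = M"
    by auto
  have "maximalideal M R"
  proof (rule maximalidealI)
    show "carrier R \<noteq> M" using M(3) by auto
    fix J assume J: "ideal J R" "M \<subseteq> J"
    then show "J = M \<or> J = carrier R"
      using max[of J] M(2) ideal.one_imp_carrier[OF J(1)] by blast
  qed (fact M(1))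
  then show ?thesis using M(2) by blast
qed

lemma (in cring) nonunit_in_maximalideal:
  assumes s: "s \<in> carrier R" and nonunit: "s \<notin> Units R"
  shows "\<exists>M. maximalideal M R \<and> s \<in> M"
proof -
  have "\<one> \<notin> PIdl s"
    using s nonunit by (auto simp: cgenideal_def Units_def m_comm)
  then show ?thesis
    using exists_maximalideal_superset[OF cgenideal_ideal[OF s]] cgenideal_self[OF s] by blast
qed

text \<open>
  The product of nonzero elements chosen from the ideals lies in each of them by absorption
  and is nonzero because there are no zero divisors; the empty family is served by \<open>\<one>\<close>.
\<close>
lemma (in domain) exists_nonzero_in_all_ideals:
  assumes "finite F" and "\<And>I. I \<in> F \<Longrightarrow> ideal I R \<and> I \<noteq> {\<zero>}"
  shows "\<exists>k \<in> carrier R - {\<zero>}. \<forall>I\<in>F. k \<in> I"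
  using assms
proof (induction F rule: finite_induct)
  case empty
  then show ?case by (intro bexI[of _ \<one>]) auto
next
  case (insert J F)
  then obtain k where k: "k \<in> carrier R" "k \<noteq> \<zero>" "\<forall>I\<in>F. k \<in> I" by auto
  interpret J: ideal J R using insert.prems by simp
  obtain x where x: "x \<in> J" "x \<noteq> \<zero>"
    using insert.prems[of J] J.zero_closed by blast
  have "x \<otimes> k \<in> I" if "I \<in> insert J F" for I
    using that k x J.I_r_closed insert.prems[of I]
    by (auto intro: ideal.I_l_closed)
  moreover have "x \<otimes> k \<in> carrier R - {\<zero>}"
    using k x by (auto simp: integral_iff)
  ultimately show ?case by blast
qed

text \<open>
  If \<open>k\<close> and \<open>s\<close> are comaximal but \<open>s\<close> is not a unit, then a maximal ideal around \<open>s\<close> also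
  contains \<open>k\<close>, and with them a combination equal to \<open>\<one>\<close>.
\<close>
lemma (in cring) macias_sigma_eq_Units:
  assumes k: "k \<in> carrier R" and radical: "\<And>M. maximalideal M R \<Longrightarrow> k \<in> M"
  shows "macias_sigma R k = Units R"
proof (intro equalityI subsetI)
  fix s assume sk: "s \<in> macias_sigma R k"
  then have s: "s \<in> carrier R" by (simp add: macias_sigma_def)
  obtain a b where ab: "a \<in> carrier R" "b \<in> carrier R" "a \<otimes> k \<oplus> b \<otimes> s = \<one>"
    using sk macias_sigma_iff[OF k s] by blast
  show "s \<in> Units R"
  proof (rule ccontr)
    assume "s \<notin> Units R"
    then obtain M where M: "maximalideal M R" "s \<in> M"
      using nonunit_in_maximalideal[OF s] by blast
    interpret M: maximalideal M R by (fact M(1))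
    have "a \<otimes> k \<oplus> b \<otimes> s \<in> M"
      using ab M radical[OF M(1)] by (intro M.a_closed M.I_l_closed)
    then show False
      using ab(3) M.one_imp_carrier M.I_notcarr by simp
  qed
next
  fix s assume s: "s \<in> Units R"
  then have "\<zero> \<otimes> k \<oplus> inv s \<otimes> s = \<one>"
    using k by simp
  then show "s \<in> macias_sigma R k"
    using s macias_sigma_iff[OF k Units_closed[OF s]] zero_closed Units_inv_closed[OF s] by blast
qed

theorem theorem4p9:
  fixes R :: "('a, 'm) ring_scheme"
  assumes "domain R"
    and "\<not> field R"
    and "\<not> openin (macias_space R) (Units R)"
  shows "infinite {M. maximalideal M R}"
proof
  assume fin: "finite {M. maximalideal M R}"
  interpret domain R by fact
  have "ideal M R \<and> M \<noteq> {\<zero>\<^bsub>R\<^esub>}" if "maximalideal M R" for M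
    using that \<open>\<not> field R\<close> zeromaximalideal_eq_field maximalideal.axioms(1) by blast
  then obtain k where k: "k \<in> carrier R - {\<zero>\<^bsub>R\<^esub>}"
    and radical: "\<And>M. maximalideal M R \<Longrightarrow> k \<in> M"
    using exists_nonzero_in_all_ideals[OF fin] by blast
  have "macias_sigma R k - {\<zero>\<^bsub>R\<^esub>} = Units R"
    using k radical macias_sigma_eq_Units[of k] zero_not_one
    by (auto simp: Units_def)
  then have "Units R \<in> macias_basis R"
    unfolding macias_basis_def using k by blast
  then have "openin (macias_space R) (Units R)"
    by (simp add: openin_macias_space union_of_inc arbitrary_def)
  with assms(3) show False by contradiction
qed

end
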